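(* Let $S$ be a zerosumfree semiring. Then the following statements are equivalent: (1) $S$ is reversible; (2) the polynomial semiring $S[X]$ is reversible; (3) the Laurent polynomial semiring $S[X;X^{-1}]$ is reversible; (4) the power series semiring $S[[X]]$ is reversible.
   Context: A semiring is an algebraic structure $(S,+,\cdot,0,1)$ such that $(S,+,0)$ is a commutative monoid, $(S,\cdot,1)$ is a (not necessarily commutative) monoid with $1\neq 0$, $a(b+c)=ab+ac$ and $(b+c)a=ba+ca$ for all $a,b,c\in S$, and $a\cdot 0=0\cdot a=0$ for all $a\in S$. $S$ is zerosumfree if $s+t=0$ implies $s=t=0$ for all $s,t\in S$. A semiring is reversible if $st=0$ implies $ts=0$ for all its elements $s,t$. In $S[X]$, $S[X;X^{-1}]$ and $S[[X]]$ the indeterminate $X$ commutes with the coefficients. *)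

theory Defs
  imports "HOL-Library.Poly_Mapping" "HOL-Computational_Algebra.Formal_Power_Series"
begin

text \<open>
  The type class \<open>semiring_1\<close> is the notion of semiring used here: multiplication need not be
  commutative, zero is absorbing, and \<open>0 \<noteq> 1\<close>. A semiring is thus given by a type, and properties
  of the whole semiring are predicates on that type.
\<close>

definition zerosumfree :: "'a::semiring_1 itself \<Rightarrow> bool" where
  "zerosumfree _ \<longleftrightarrow> (\<forall>s t :: 'a. s + t = 0 \<longrightarrow> s = 0 \<and> t = 0)"

definition reversible :: "'a::semiring_1 itself \<Rightarrow> bool" where
  "reversible _ \<longleftrightarrow> (\<forall>s t :: 'a. s * t = 0 \<longrightarrow> t * s = 0)"

text \<open>
  The library type \<open>'a poly\<close> carries a multiplication only for commutative coefficients. Over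
  arbitrary coefficients, polynomials and Laurent polynomials are the finitely supported functions
  from the exponents to the coefficients, with convolution as product: the coefficient of \<open>f * g\<close>
  at \<open>k\<close> is the sum of \<open>f i * g j\<close> over \<open>i + j = k\<close>. So the indeterminate, which is
  \<open>Poly_Mapping.single 1 1\<close>, commutes with the coefficients. The type \<open>'a fps\<close> of formal power
  series has the same convolution product without any commutativity requirement.
\<close>

type_synonym 'a polynomial = "nat \<Rightarrow>\<^sub>0 'a"

type_synonym 'a laurent_polynomial = "int \<Rightarrow>\<^sub>0 'a"

end

theory Submission
  imports Defs
begin

text \<open>In a zerosumfree semiring a convolution product \<open>f * g\<close> vanishes iff every product
  \<open>f i * g j\<close> of coefficients vanishes, since the coefficients of \<open>f * g\<close> are finite sums of such
  products. This condition is symmetric in \<open>f\<close> and \<open>g\<close> as soon as the coefficients are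
  reversible; conversely, the coefficients embed as the constants.\<close>

lemma zerosumfree_sum_eq_0_iff:
  fixes h :: "'i \<Rightarrow> 'a::semiring_1"
  assumes "zerosumfree TYPE('a)" and "finite A"
  shows "sum h A = 0 \<longleftrightarrow> (\<forall>x\<in>A. h x = 0)"
  using assms(2)
proof induction
  case (insert x A)
  moreover have "s + t = 0 \<longleftrightarrow> s = 0 \<and> t = 0" for s t :: 'a
    using assms(1) unfolding zerosumfree_def by (metis add_0)
  ultimately show ?case by simp
qed simp

text \<open>The exponents range over an arbitrary additive monoid, so that \<open>nat\<close> and
  \<open>int\<close> are both instances.\<close>

lemma poly_mapping_mult_eq_0_iff:
  fixes f g :: "'m::monoid_add \<Rightarrow>\<^sub>0 'a::semiring_1"
  assumes "zerosumfree TYPE('a)"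
  shows "f * g = 0 \<longleftrightarrow> (\<forall>i j. Poly_Mapping.lookup f i * Poly_Mapping.lookup g j = 0)"
proof -
  \<comment> \<open>Summing over the fixed finite set of pairs of keys, with the condition on
    \<open>k\<close> moved into the summand, makes \<open>zerosumfree_sum_eq_0_iff\<close>
    applicable.\<close>
  have lookup_mult_keys: "Poly_Mapping.lookup (f * g) k =
      (\<Sum>(i, j) \<in> Poly_Mapping.keys f \<times> Poly_Mapping.keys g.
        Poly_Mapping.lookup f i * Poly_Mapping.lookup g j when k = i + j)"
    for k
    unfolding times_poly_mapping.rep_eq prod_fun_unfold_prod[OF finite_lookup finite_lookup]
    by (rule Sum_any.expand_superset) (auto simp: in_keys_iff)
  have "f * g = 0 \<longleftrightarrow> (\<forall>k. Poly_Mapping.lookup (f * g) k = 0)"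
    by (simp add: poly_mapping_eq_iff fun_eq_iff)
  also have "\<dots> \<longleftrightarrow> (\<forall>k. \<forall>i\<in>Poly_Mapping.keys f. \<forall>j\<in>Poly_Mapping.keys g.
        (Poly_Mapping.lookup f i * Poly_Mapping.lookup g j when k = i + j) = 0)"
    by (simp add: lookup_mult_keys zerosumfree_sum_eq_0_iff[OF assms])
  \<comment> \<open>Since \<open>k\<close> ranges over all exponents, each pair meets its guard at
    \<open>k = i + j\<close>.\<close>
  also have "\<dots> \<longleftrightarrow> (\<forall>i\<in>Poly_Mapping.keys f. \<forall>j\<in>Poly_Mapping.keys g.
        Poly_Mapping.lookup f i * Poly_Mapping.lookup g j = 0)"
    by (auto simp: when_def)
  also have "\<dots> \<longleftrightarrow> (\<forall>i j. Poly_Mapping.lookup f i * Poly_Mapping.lookup g j = 0)"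
    by (metis in_keys_iff mult_zero_left mult_zero_right)
  finally show ?thesis .
qed

text \<open>Supports may be infinite here, but each coefficient of the product is still a finite
  sum.\<close>

lemma fps_mult_eq_0_iff:
  includes fps_syntax
  fixes f g :: "'a::semiring_1 fps"
  assumes "zerosumfree TYPE('a)"
  shows "f * g = 0 \<longleftrightarrow> (\<forall>i j. f $ i * g $ j = 0)"
proof
  assume "f * g = 0"
  \<comment> \<open>The coefficient at \<open>i + j\<close> is chosen because its summand at
    \<open>l = i\<close> is \<open>f $ i * g $ j\<close>.\<close>
  then have "(\<Sum>l = 0..i + j. f $ l * g $ (i + j - l)) = 0" for i j
    by (metis fps_mult_nth fps_zero_nth)
  then have "\<forall>l\<in>{0..i + j}. f $ l * g $ (i + j - l) = 0" for i j
    by (simp only: zerosumfree_sum_eq_0_iff[OF assms finite_atLeastAtMost])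
  then have "f $ i * g $ (i + j - i) = 0" for i j
    using le_add1 by fastforce
  then show "\<forall>i j. f $ i * g $ j = 0"
    by simp
next
  assume "\<forall>i j. f $ i * g $ j = 0"
  then show "f * g = 0"
    by (auto intro!: fps_ext simp: fps_mult_nth)
qed

lemma reversible_poly_mapping_iff:
  assumes "zerosumfree TYPE('a::semiring_1)"
  shows "reversible TYPE('m::monoid_add \<Rightarrow>\<^sub>0 'a) \<longleftrightarrow> reversible TYPE('a)"
proof
  assume *: "reversible TYPE('m \<Rightarrow>\<^sub>0 'a)"
  show "reversible TYPE('a)"
    unfolding reversible_def
  proof (intro allI impI)
    fix s t :: 'a
    assume "s * t = 0"
    \<comment> \<open>Elements supported at exponent \<open>0\<close> multiply like their
      coefficients, because \<open>0 + 0 = 0\<close>; reading off the coefficient at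
      \<open>0\<close> later recovers \<open>t * s\<close>.\<close>
    then have "Poly_Mapping.single (0::'m) s * Poly_Mapping.single 0 t = 0"
      by (simp add: mult_single)
    with * have "Poly_Mapping.single (0::'m) t * Poly_Mapping.single 0 s = 0"
      unfolding reversible_def by blast
    then show "t * s = 0"
      by (metis add_0 lookup_single_eq lookup_zero mult_single)
  qed
next
  assume "reversible TYPE('a)"
  then show "reversible TYPE('m \<Rightarrow>\<^sub>0 'a)"
    unfolding reversible_def poly_mapping_mult_eq_0_iff[OF assms] by blast
qed

lemma reversible_fps_iff:
  assumes "zerosumfree TYPE('a::semiring_1)"
  shows "reversible TYPE('a fps) \<longleftrightarrow> reversible TYPE('a)"
proof
  assume *: "reversible TYPE('a fps)"
  show "reversible TYPE('a)"
    unfolding reversible_def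
  proof (intro allI impI)
    fix s t :: 'a
    assume "s * t = 0"
    then have "fps_const s * fps_const t = 0"
      by simp
    with * have "fps_const t * fps_const s = 0"
      unfolding reversible_def by blast
    then show "t * s = 0"
      by simp
  qed
next
  assume "reversible TYPE('a)"
  then show "reversible TYPE('a fps)"
    unfolding reversible_def fps_mult_eq_0_iff[OF assms] by blast
qed

theorem corollary4p15:
  assumes "zerosumfree TYPE('a::semiring_1)"
  shows "(reversible TYPE('a) \<longleftrightarrow> reversible TYPE('a polynomial)) \<and>
         (reversible TYPE('a) \<longleftrightarrow> reversible TYPE('a laurent_polynomial)) \<and>
         (reversible TYPE('a) \<longleftrightarrow> reversible TYPE('a fps))"
  by (simp add: reversible_poly_mapping_iff[OF assms] reversible_fps_iff[OF assms])

end
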